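(* Let $\mathcal S^0=(\mathcal M,\mathcal C,T_l,T_r,\Pi,t,i)$ be a dual admissible septuple and let $w:T_lX\to T_rX$ be a transposition morphism with respect to $\mathcal S^0$, where $X$ is an object of $\mathcal M$. For $n\ge0$ let $Z_n(\mathcal S^0,X):=\Pi T_l^{\,n+1}X$, with face morphisms $d_k:=\Pi T_l^{k}\varepsilon_{T_l}T_l^{n-k}X:\Pi T_l^{n+1}X\to\Pi T_l^nX$ and degeneracy morphisms $s_k:=\Pi T_l^k\Delta_{T_l}T_l^{n-k}X:\Pi T_l^{n+1}X\to\Pi T_l^{n+2}X$, for $k\in\{0,\dots,n\}$. Then the simplicial object $Z_\ast(\mathcal S^0,X)$ in $\mathcal C$ is para-cyclic with para-cyclic morphism $$w_n:=iT_l^nX\circ t_n^0X\circ\Pi T_l^nw:\ \Pi T_l^{n+1}X\to\Pi T_l^{n+1}X.$$ Denote this para-cyclic object by $Z_\ast(\mathcal S^0,w)$. For every morphism $f:(X,w)\to(X',w')$ in $\mathcal W_{\mathcal S^0}$, the morphisms $\Pi T_l^{n+1}f:Z_n(\mathcal S^0,w)\to Z_n(\mathcal S^0,w')$ determine a morphism of para-cyclic objects.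
   Context: Horizontal composition of functors and natural transformations is denoted by juxtaposition, vertical composition by $\circ$. A comonad on $\mathcal M$ is a triple $(T,\Delta_T,\varepsilon_T)$ with $T:\mathcal M\to\mathcal M$ a functor and $\Delta_T:T\to T^2$, $\varepsilon_T:T\to\mathrm{Id}$ a coassociative comultiplication and a counit. For comonads $T_l,T_r$ on $\mathcal M$, a dual distributive law is a natural transformation $t:T_lT_r\to T_rT_l$ which is a distributive law for the corresponding monads on $\mathcal M^{op}$, i.e. $\Delta_{T_r}T_l\circ t=T_rt\circ tT_r\circ T_l\Delta_{T_r}$, $T_r\Delta_{T_l}\circ t=tT_l\circ T_lt\circ\Delta_{T_l}T_r$, $\varepsilon_{T_r}T_l\circ t=T_l\varepsilon_{T_r}$, $T_r\varepsilon_{T_l}\circ t=\varepsilon_{T_l}T_r$. A dual admissible septuple $\mathcal S^0=(\mathcal M,\mathcal C,T_l,T_r,\Pi,t,i)$ consists of categories $\mathcal M,\mathcal C$; comonads $T_l,T_r$ on $\mathcal M$; a covariant functor $\Pi:\mathcal M\to\mathcal C$; a dual distributive law $t:T_lT_r\to T_rT_l$; and a natural transformation $i:\Pi T_r\to\Pi T_l$, such that $\Pi\varepsilon_{T_l}\circ i=\Pi\varepsilon_{T_r}$ and $\Pi\Delta_{T_l}\circ i=iT_l\circ\Pi t\circ iT_r\circ\Pi\Delta_{T_r}$. The natural transformation $t_n^0:\Pi T_l^nT_r\to\Pi T_rT_l^n$ is $t^0_n:=\Pi tT_l^{n-1}\circ\Pi T_ltT_l^{n-2}\circ\dots\circ\Pi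 T_l^{n-2}tT_l\circ\Pi T_l^{n-1}t$ (the identity if $n=0$). A transposition morphism with respect to $\mathcal S^0$ is a morphism $w:T_lX\to T_rX$ in $\mathcal M$ with $\varepsilon_{T_r}X\circ w=\varepsilon_{T_l}X$ and $\Delta_{T_r}X\circ w=T_rw\circ tX\circ T_lw\circ\Delta_{T_l}X$. The category $\mathcal W_{\mathcal S^0}$ has as objects the pairs $(X,w)$ with $w$ a transposition morphism; a morphism $(X,w)\to(X',w')$ is a morphism $f:X\to X'$ in $\mathcal M$ with $T_rf\circ w=w'\circ T_lf$. A para-cyclic object is a simplicial object $(Z_n,d_k:Z_n\to Z_{n-1},s_k:Z_n\to Z_{n+1})$ with morphisms $w_n:Z_n\to Z_n$ satisfying $d_0w_n=d_n$, $d_kw_n=w_{n-1}d_{k-1}$, $s_0w_n=(w_{n+1})^2s_n$, $s_kw_n=w_{n+1}s_{k-1}$ for $1\le k\le n$ (the relations with faces being required for $n\ge1$). Morphisms of para-cyclic objects are morphisms of simplicial objects commuting with the $w_n$. *)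

theory Defs
  imports Main
begin

section \<open>Categories, functors, natural transformations\<close>

record ('o, 'a) cat =
  obj   :: "'o set"
  arr   :: "'a set"
  src   :: "'a \<Rightarrow> 'o"
  tgt   :: "'a \<Rightarrow> 'o"
  ident :: "'o \<Rightarrow> 'a"
  cmp   :: "'a \<Rightarrow> 'a \<Rightarrow> 'a"  (infixr "\<cdot>\<index>" 70)

definition hom :: "('o, 'a) cat \<Rightarrow> 'o \<Rightarrow> 'o \<Rightarrow> 'a set" where
  "hom C X Y = {f \<in> arr C. src C f = X \<and> tgt C f = Y}"

text \<open>Composition is written in applicative order: \<open>g \<cdot>\<^bsub>C\<^esub> f\<close> means \<open>g\<close> after \<open>f\<close>.\<close>

locale category =
  fixes C :: "('o, 'a) cat" (structure)
  assumes src_in: "f \<in> arr C \<Longrightarrow> src C f \<in> obj C"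
    and tgt_in: "f \<in> arr C \<Longrightarrow> tgt C f \<in> obj C"
    and ident_hom: "X \<in> obj C \<Longrightarrow> ident C X \<in> hom C X X"
    and cmp_hom: "\<lbrakk>f \<in> hom C X Y; g \<in> hom C Y Z\<rbrakk> \<Longrightarrow> g \<cdot> f \<in> hom C X Z"
    and ident_left: "f \<in> hom C X Y \<Longrightarrow> ident C Y \<cdot> f = f"
    and ident_right: "f \<in> hom C X Y \<Longrightarrow> f \<cdot> ident C X = f"
    and cmp_assoc: "\<lbrakk>f \<in> hom C W X; g \<in> hom C X Y; h \<in> hom C Y Z\<rbrakk>
          \<Longrightarrow> (h \<cdot> g) \<cdot> f = h \<cdot> (g \<cdot> f)"

record ('o, 'a, 'p, 'b) cfunctor =
  fobj :: "'o \<Rightarrow> 'p"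
  farr :: "'a \<Rightarrow> 'b"

locale cat_functor =
  dom: category C + cod: category D
  for C :: "('o, 'a) cat" and D :: "('p, 'b) cat" +
  fixes F :: "('o, 'a, 'p, 'b, 'x) cfunctor_scheme"
  assumes fobj_in: "X \<in> obj C \<Longrightarrow> fobj F X \<in> obj D"
    and farr_hom: "f \<in> hom C X Y \<Longrightarrow> farr F f \<in> hom D (fobj F X) (fobj F Y)"
    and farr_ident: "X \<in> obj C \<Longrightarrow> farr F (ident C X) = ident D (fobj F X)"
    and farr_cmp: "\<lbrakk>f \<in> hom C X Y; g \<in> hom C Y Z\<rbrakk>
          \<Longrightarrow> farr F (g \<cdot>\<^bsub>C\<^esub> f) = farr F g \<cdot>\<^bsub>D\<^esub> farr F f"

definition fid :: "('o, 'a, 'o, 'a) cfunctor" where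
  "fid = \<lparr>fobj = (\<lambda>X. X), farr = (\<lambda>f. f)\<rparr>"

definition fcomp ::
  "('p, 'b, 'q, 'c, 'y) cfunctor_scheme \<Rightarrow> ('o, 'a, 'p, 'b, 'x) cfunctor_scheme
    \<Rightarrow> ('o, 'a, 'q, 'c) cfunctor"  (infixr "\<star>" 80) where
  "G \<star> F = \<lparr>fobj = (\<lambda>X. fobj G (fobj F X)), farr = (\<lambda>f. farr G (farr F f))\<rparr>"

primrec fpow :: "('o, 'a, 'o, 'a, 'x) cfunctor_scheme \<Rightarrow> nat \<Rightarrow> ('o, 'a, 'o, 'a) cfunctor"
  (infixr "^^^" 90) where
  "T ^^^ 0 = fid"
| "T ^^^ Suc n = T \<star> (T ^^^ n)"

text \<open>A natural transformation between functors \<open>C \<rightarrow> D\<close> is represented by its family of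
  components.  The values of the family outside \<open>obj C\<close> carry no meaning, so equality of natural
  transformations is the relation \<open>nt_eq C\<close> below.\<close>

locale nat_transformation =
  F: cat_functor C D F + G: cat_functor C D G
  for C :: "('o, 'a) cat" and D :: "('p, 'b) cat"
    and F :: "('o, 'a, 'p, 'b, 'x) cfunctor_scheme"
    and G :: "('o, 'a, 'p, 'b, 'y) cfunctor_scheme" +
  fixes \<alpha> :: "'o \<Rightarrow> 'b"
  assumes component_hom: "X \<in> obj C \<Longrightarrow> \<alpha> X \<in> hom D (fobj F X) (fobj G X)"
    and naturality: "f \<in> hom C X Y \<Longrightarrow> \<alpha> Y \<cdot>\<^bsub>D\<^esub> farr F f = farr G f \<cdot>\<^bsub>D\<^esub> \<alpha> X"

definition nt_eq :: "('o, 'a) cat \<Rightarrow> ('o \<Rightarrow> 'b) \<Rightarrow> ('o \<Rightarrow> 'b) \<Rightarrow> bool"  (infix "\<approx>\<index>" 50) where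
  "nt_eq C \<alpha> \<beta> \<longleftrightarrow> (\<forall>X\<in>obj C. \<alpha> X = \<beta> X)"

definition nt_id :: "('p, 'b) cat \<Rightarrow> ('o, 'a, 'p, 'b, 'x) cfunctor_scheme \<Rightarrow> 'o \<Rightarrow> 'b" where
  "nt_id D F = (\<lambda>X. ident D (fobj F X))"

definition vcomp :: "('p, 'b) cat \<Rightarrow> ('o \<Rightarrow> 'b) \<Rightarrow> ('o \<Rightarrow> 'b) \<Rightarrow> 'o \<Rightarrow> 'b"
  (infixr "\<bullet>\<index>" 65) where
  "vcomp D \<beta> \<alpha> = (\<lambda>X. \<beta> X \<cdot>\<^bsub>D\<^esub> \<alpha> X)"

text \<open>Horizontal composition with an identity transformation: \<open>F \<rhd> \<alpha>\<close> is \<open>F\<alpha>\<close> and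
  \<open>\<alpha> \<lhd> G\<close> is \<open>\<alpha>G\<close>; for \<open>F\<alpha>G\<close> we write \<open>F \<rhd> \<alpha> \<lhd> G\<close>.\<close>

definition whisker_right :: "('o \<Rightarrow> 'b) \<Rightarrow> ('n, 'c, 'o, 'a, 'x) cfunctor_scheme \<Rightarrow> 'n \<Rightarrow> 'b"
  (infixl "\<lhd>" 76) where
  "\<alpha> \<lhd> G = (\<lambda>X. \<alpha> (fobj G X))"

definition whisker_left :: "('p, 'b, 'q, 'c, 'x) cfunctor_scheme \<Rightarrow> ('o \<Rightarrow> 'b) \<Rightarrow> 'o \<Rightarrow> 'c"
  (infixr "\<rhd>" 75) where
  "F \<rhd> \<alpha> = (\<lambda>X. farr F (\<alpha> X))"


section \<open>Comonads and dual admissible septuples\<close>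

record ('o, 'a) comonad_data = "('o, 'a, 'o, 'a) cfunctor" +
  comult :: "'o \<Rightarrow> 'a"
  counit :: "'o \<Rightarrow> 'a"

locale comonad =
  functor_T: cat_functor M M T +
  comult: nat_transformation M M T "T \<star> T" "comult T" +
  counit: nat_transformation M M T fid "counit T"
  for M :: "('o, 'a) cat" and T :: "('o, 'a) comonad_data" +
  assumes coassoc: "(T \<rhd> comult T) \<bullet>\<^bsub>M\<^esub> comult T \<approx>\<^bsub>M\<^esub> (comult T \<lhd> T) \<bullet>\<^bsub>M\<^esub> comult T"
    and counit_left: "(counit T \<lhd> T) \<bullet>\<^bsub>M\<^esub> comult T \<approx>\<^bsub>M\<^esub> nt_id M T"
    and counit_right: "(T \<rhd> counit T) \<bullet>\<^bsub>M\<^esub> comult T \<approx>\<^bsub>M\<^esub> nt_id M T"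

locale dual_distributive_law =
  left: comonad M Tl + right: comonad M Tr +
  law: nat_transformation M M "Tl \<star> Tr" "Tr \<star> Tl" t
  for M :: "('o, 'a) cat" and Tl Tr :: "('o, 'a) comonad_data" and t :: "'o \<Rightarrow> 'a" +
  assumes comult_right:
    "(comult Tr \<lhd> Tl) \<bullet>\<^bsub>M\<^esub> t \<approx>\<^bsub>M\<^esub> (Tr \<rhd> t) \<bullet>\<^bsub>M\<^esub> (t \<lhd> Tr) \<bullet>\<^bsub>M\<^esub> (Tl \<rhd> comult Tr)"
    and comult_left:
    "(Tr \<rhd> comult Tl) \<bullet>\<^bsub>M\<^esub> t \<approx>\<^bsub>M\<^esub> (t \<lhd> Tl) \<bullet>\<^bsub>M\<^esub> (Tl \<rhd> t) \<bullet>\<^bsub>M\<^esub> (comult Tl \<lhd> Tr)"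
    and counit_right: "(counit Tr \<lhd> Tl) \<bullet>\<^bsub>M\<^esub> t \<approx>\<^bsub>M\<^esub> Tl \<rhd> counit Tr"
    and counit_left: "(Tr \<rhd> counit Tl) \<bullet>\<^bsub>M\<^esub> t \<approx>\<^bsub>M\<^esub> counit Tl \<lhd> Tr"

record ('o, 'a, 'p, 'b) septuple =
  catM :: "('o, 'a) cat"
  catC :: "('p, 'b) cat"
  Tl   :: "('o, 'a) comonad_data"
  Tr   :: "('o, 'a) comonad_data"
  PiF  :: "('o, 'a, 'p, 'b) cfunctor"
  tlaw :: "'o \<Rightarrow> 'a"
  itr  :: "'o \<Rightarrow> 'b"

locale dual_admissible_septuple =
  distr: dual_distributive_law "catM S" "Tl S" "Tr S" "tlaw S" +
  Pi: cat_functor "catM S" "catC S" "PiF S" +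
  itr: nat_transformation "catM S" "catC S" "PiF S \<star> Tr S" "PiF S \<star> Tl S" "itr S"
  for S :: "('o, 'a, 'p, 'b) septuple" +
  assumes itr_counit:
    "(PiF S \<rhd> counit (Tl S)) \<bullet>\<^bsub>catC S\<^esub> itr S \<approx>\<^bsub>catM S\<^esub> PiF S \<rhd> counit (Tr S)"
    and itr_comult:
    "(PiF S \<rhd> comult (Tl S)) \<bullet>\<^bsub>catC S\<^esub> itr S
      \<approx>\<^bsub>catM S\<^esub> (itr S \<lhd> Tl S) \<bullet>\<^bsub>catC S\<^esub> (PiF S \<rhd> tlaw S)
        \<bullet>\<^bsub>catC S\<^esub> (itr S \<lhd> Tr S) \<bullet>\<^bsub>catC S\<^esub> (PiF S \<rhd> comult (Tr S))"

text \<open>The fold is \<open>\<Pi>tT\<^sub>l\<^sup>n\<^sup>-\<^sup>1 \<circ> \<Pi>T\<^sub>ltT\<^sub>l\<^sup>n\<^sup>-\<^sup>2 \<circ> \<dots> \<circ> \<Pi>T\<^sub>l\<^sup>n\<^sup>-\<^sup>1t\<close>, the factor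
  with \<open>k = 0\<close> being the leftmost one, followed on the right by the identity of \<open>\<Pi>T\<^sub>l\<^sup>nT\<^sub>r\<close>.\<close>

definition t0 :: "('o, 'a, 'p, 'b) septuple \<Rightarrow> nat \<Rightarrow> 'o \<Rightarrow> 'b" where
  "t0 S n =
    foldr (\<lambda>k \<gamma>. (PiF S \<star> Tl S ^^^ k \<rhd> tlaw S \<lhd> Tl S ^^^ (n - 1 - k)) \<bullet>\<^bsub>catC S\<^esub> \<gamma>)
      [0..<n] (nt_id (catC S) (PiF S \<star> Tl S ^^^ n \<star> Tr S))"


section \<open>Transposition morphisms and their category\<close>

definition transposition_morphism ::
  "('o, 'a, 'p, 'b) septuple \<Rightarrow> 'o \<Rightarrow> 'a \<Rightarrow> bool" where
  "transposition_morphism S X w \<longleftrightarrow>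
    X \<in> obj (catM S) \<and>
    w \<in> hom (catM S) (fobj (Tl S) X) (fobj (Tr S) X) \<and>
    counit (Tr S) X \<cdot>\<^bsub>catM S\<^esub> w = counit (Tl S) X \<and>
    comult (Tr S) X \<cdot>\<^bsub>catM S\<^esub> w =
      farr (Tr S) w \<cdot>\<^bsub>catM S\<^esub> tlaw S X \<cdot>\<^bsub>catM S\<^esub> farr (Tl S) w \<cdot>\<^bsub>catM S\<^esub> comult (Tl S) X"

text \<open>One morphism of \<open>catM S\<close> may be a morphism between several pairs of objects of \<open>Wcat S\<close>; an
  arrow is therefore a triple \<open>(A, f, B)\<close> recording its source and its target.\<close>

definition Wcat ::
  "('o, 'a, 'p, 'b) septuple \<Rightarrow> ('o \<times> 'a, ('o \<times> 'a) \<times> 'a \<times> ('o \<times> 'a)) cat" where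
  "Wcat S = \<lparr>
    obj = {(X, w). transposition_morphism S X w},
    arr = {((X, w), f, (X', w')) | X w f X' w'.
             transposition_morphism S X w \<and> transposition_morphism S X' w' \<and>
             f \<in> hom (catM S) X X' \<and>
             farr (Tr S) f \<cdot>\<^bsub>catM S\<^esub> w = w' \<cdot>\<^bsub>catM S\<^esub> farr (Tl S) f},
    src = (\<lambda>(A, f, B). A),
    tgt = (\<lambda>(A, f, B). B),
    ident = (\<lambda>A. (A, ident (catM S) (fst A), A)),
    cmp = (\<lambda>(B', g, D) (A, f, B). (A, g \<cdot>\<^bsub>catM S\<^esub> f, D))\<rparr>"

lemma Wcat_hom_iff:
  "((X, w), f, (X', w')) \<in> hom (Wcat S) (X, w) (X', w') \<longleftrightarrow>
    transposition_morphism S X w \<and> transposition_morphism S X' w' \<and>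
    f \<in> hom (catM S) X X' \<and> farr (Tr S) f \<cdot>\<^bsub>catM S\<^esub> w = w' \<cdot>\<^bsub>catM S\<^esub> farr (Tl S) f"
  by (auto simp: hom_def Wcat_def)

lemma Wcat_homE:
  assumes "\<phi> \<in> hom (Wcat S) A B"
  obtains X w f X' w' where "A = (X, w)" "B = (X', w')" "\<phi> = ((X, w), f, (X', w'))"
    "transposition_morphism S X w" "transposition_morphism S X' w'"
    "f \<in> hom (catM S) X X'" "farr (Tr S) f \<cdot>\<^bsub>catM S\<^esub> w = w' \<cdot>\<^bsub>catM S\<^esub> farr (Tl S) f"
  using assms by (auto simp: hom_def Wcat_def)

lemma Wcat_category:
  assumes "dual_admissible_septuple S"
  shows "category (Wcat S)"
proof -
  interpret dual_admissible_septuple S by fact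
  let ?M = "catM S"
  have M: "category ?M" using Pi.cat_functor_axioms by (rule cat_functor.axioms)
  have TL: "cat_functor ?M ?M (Tl S)" and TR: "cat_functor ?M ?M (Tr S)"
    by (rule distr.left.functor_T.cat_functor_axioms, rule distr.right.functor_T.cat_functor_axioms)
  note L = cat_functor.farr_hom[OF TL] and R = cat_functor.farr_hom[OF TR]
  show ?thesis
  proof
    show "src (Wcat S) f \<in> obj (Wcat S)" "tgt (Wcat S) f \<in> obj (Wcat S)"
      if "f \<in> arr (Wcat S)" for f
      using that by (auto simp: Wcat_def)
  next
    fix A assume "A \<in> obj (Wcat S)"
    then obtain X w where A: "A = (X, w)" and w: "transposition_morphism S X w"
      by (auto simp: Wcat_def)
    then have X: "X \<in> obj ?M" and wh: "w \<in> hom ?M (fobj (Tl S) X) (fobj (Tr S) X)"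
      by (auto simp: transposition_morphism_def)
    have "(A, ident ?M X, A) \<in> hom (Wcat S) A A"
      unfolding A Wcat_hom_iff
      using w category.ident_hom[OF M X] cat_functor.farr_ident[OF TL X]
        cat_functor.farr_ident[OF TR X] category.ident_left[OF M wh] category.ident_right[OF M wh]
      by simp
    then show "ident (Wcat S) A \<in> hom (Wcat S) A A" by (simp add: Wcat_def A)
  next
    fix \<phi> \<psi> A B D assume "\<phi> \<in> hom (Wcat S) A B" "\<psi> \<in> hom (Wcat S) B D"
    then obtain X w f X' w' g X'' w'' where
      AB: "A = (X, w)" "B = (X', w')" "\<phi> = ((X, w), f, (X', w'))"
      "D = (X'', w'')" "\<psi> = ((X', w'), g, (X'', w''))"
      and t: "transposition_morphism S X w" "transposition_morphism S X' w'"
        "transposition_morphism S X'' w''"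
      and f: "f \<in> hom ?M X X'" and g: "g \<in> hom ?M X' X''"
      and fw: "farr (Tr S) f \<cdot>\<^bsub>?M\<^esub> w = w' \<cdot>\<^bsub>?M\<^esub> farr (Tl S) f"
      and gw: "farr (Tr S) g \<cdot>\<^bsub>?M\<^esub> w' = w'' \<cdot>\<^bsub>?M\<^esub> farr (Tl S) g"
      by (elim Wcat_homE) auto
    have h: "w \<in> hom ?M (fobj (Tl S) X) (fobj (Tr S) X)"
      "w' \<in> hom ?M (fobj (Tl S) X') (fobj (Tr S) X')"
      "w'' \<in> hom ?M (fobj (Tl S) X'') (fobj (Tr S) X'')"
      using t by (auto simp: transposition_morphism_def)
    have "farr (Tr S) (g \<cdot>\<^bsub>?M\<^esub> f) \<cdot>\<^bsub>?M\<^esub> w = farr (Tr S) g \<cdot>\<^bsub>?M\<^esub> (farr (Tr S) f \<cdot>\<^bsub>?M\<^esub> w)"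
      using cat_functor.farr_cmp[OF TR f g] category.cmp_assoc[OF M h(1) R[OF f] R[OF g]] by simp
    also have "\<dots> = (farr (Tr S) g \<cdot>\<^bsub>?M\<^esub> w') \<cdot>\<^bsub>?M\<^esub> farr (Tl S) f"
      using category.cmp_assoc[OF M L[OF f] h(2) R[OF g]] fw by simp
    also have "\<dots> = w'' \<cdot>\<^bsub>?M\<^esub> farr (Tl S) (g \<cdot>\<^bsub>?M\<^esub> f)"
      using cat_functor.farr_cmp[OF TL f g] category.cmp_assoc[OF M L[OF f] L[OF g] h(3)] gw by simp
    finally have "((X, w), g \<cdot>\<^bsub>?M\<^esub> f, (X'', w'')) \<in> hom (Wcat S) (X, w) (X'', w'')"
      unfolding Wcat_hom_iff using t f g category.cmp_hom[OF M] by blast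
    then show "\<psi> \<cdot>\<^bsub>Wcat S\<^esub> \<phi> \<in> hom (Wcat S) A D" using AB by (simp add: Wcat_def)
  next
    fix \<phi> A B assume "\<phi> \<in> hom (Wcat S) A B"
    then show "ident (Wcat S) B \<cdot>\<^bsub>Wcat S\<^esub> \<phi> = \<phi>" "\<phi> \<cdot>\<^bsub>Wcat S\<^esub> ident (Wcat S) A = \<phi>"
      by - (elim Wcat_homE; simp add: Wcat_def category.ident_left[OF M] category.ident_right[OF M])+
  next
    fix \<phi> \<psi> \<chi> A B D E
    assume "\<phi> \<in> hom (Wcat S) A B" "\<psi> \<in> hom (Wcat S) B D" "\<chi> \<in> hom (Wcat S) D E"
    then show "(\<chi> \<cdot>\<^bsub>Wcat S\<^esub> \<psi>) \<cdot>\<^bsub>Wcat S\<^esub> \<phi> = \<chi> \<cdot>\<^bsub>Wcat S\<^esub> (\<psi> \<cdot>\<^bsub>Wcat S\<^esub> \<phi>)"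
      by - (elim Wcat_homE; simp add: Wcat_def category.cmp_assoc[OF M])+
  qed
qed


section \<open>Simplicial and para-cyclic objects\<close>

text \<open>\<open>face Z n k\<close> and \<open>degen Z n k\<close> are the maps \<open>d\<^sub>k : Z\<^sub>n \<rightarrow> Z\<^sub>n\<^sub>-\<^sub>1\<close> and
  \<open>s\<^sub>k : Z\<^sub>n \<rightarrow> Z\<^sub>n\<^sub>+\<^sub>1\<close> for \<open>k \<le> n\<close>.  Faces are meaningful only for \<open>n \<ge> 1\<close>.\<close>

record ('p, 'b) simplicial_data =
  deg   :: "nat \<Rightarrow> 'p"
  face  :: "nat \<Rightarrow> nat \<Rightarrow> 'b"
  degen :: "nat \<Rightarrow> nat \<Rightarrow> 'b"

locale simplicial_object = category C
  for C :: "('p, 'b) cat" (structure) +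
  fixes Z :: "('p, 'b) simplicial_data"
  assumes deg_in: "deg Z n \<in> obj C"
    and face_hom: "\<lbrakk>n \<ge> 1; k \<le> n\<rbrakk> \<Longrightarrow> face Z n k \<in> hom C (deg Z n) (deg Z (n - 1))"
    and degen_hom: "k \<le> n \<Longrightarrow> degen Z n k \<in> hom C (deg Z n) (deg Z (n + 1))"
    and face_face: "\<lbrakk>n \<ge> 2; j < k; k \<le> n\<rbrakk> \<Longrightarrow>
          face Z (n - 1) j \<cdot> face Z n k = face Z (n - 1) (k - 1) \<cdot> face Z n j"
    and degen_degen: "\<lbrakk>j \<le> k; k \<le> n\<rbrakk> \<Longrightarrow>
          degen Z (n + 1) j \<cdot> degen Z n k = degen Z (n + 1) (k + 1) \<cdot> degen Z n j"
    and face_degen_less: "\<lbrakk>j < k; k \<le> n\<rbrakk> \<Longrightarrow>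
          face Z (n + 1) j \<cdot> degen Z n k = degen Z (n - 1) (k - 1) \<cdot> face Z n j"
    and face_degen_same: "k \<le> n \<Longrightarrow> face Z (n + 1) k \<cdot> degen Z n k = ident C (deg Z n)"
    and face_degen_next: "k \<le> n \<Longrightarrow> face Z (n + 1) (k + 1) \<cdot> degen Z n k = ident C (deg Z n)"
    and face_degen_greater: "\<lbrakk>k + 1 < j; j \<le> n + 1\<rbrakk> \<Longrightarrow>
          face Z (n + 1) j \<cdot> degen Z n k = degen Z (n - 1) k \<cdot> face Z n (j - 1)"

locale para_cyclic_object = simplicial_object C Z
  for C :: "('p, 'b) cat" (structure) and Z :: "('p, 'b) simplicial_data" +
  fixes w :: "nat \<Rightarrow> 'b"
  assumes cyc_hom: "w n \<in> hom C (deg Z n) (deg Z n)"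
    and face_cyc_0: "n \<ge> 1 \<Longrightarrow> face Z n 0 \<cdot> w n = face Z n n"
    and face_cyc: "\<lbrakk>1 \<le> k; k \<le> n\<rbrakk> \<Longrightarrow> face Z n k \<cdot> w n = w (n - 1) \<cdot> face Z n (k - 1)"
    and degen_cyc_0: "degen Z n 0 \<cdot> w n = (w (n + 1) \<cdot> w (n + 1)) \<cdot> degen Z n n"
    and degen_cyc: "\<lbrakk>1 \<le> k; k \<le> n\<rbrakk> \<Longrightarrow> degen Z n k \<cdot> w n = w (n + 1) \<cdot> degen Z n (k - 1)"

locale simplicial_morphism =
  source: simplicial_object C Z + target: simplicial_object C Z'
  for C :: "('p, 'b) cat" (structure) and Z Z' :: "('p, 'b) simplicial_data" +
  fixes \<phi> :: "nat \<Rightarrow> 'b"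
  assumes mor_hom: "\<phi> n \<in> hom C (deg Z n) (deg Z' n)"
    and mor_face: "\<lbrakk>n \<ge> 1; k \<le> n\<rbrakk> \<Longrightarrow> face Z' n k \<cdot> \<phi> n = \<phi> (n - 1) \<cdot> face Z n k"
    and mor_degen: "k \<le> n \<Longrightarrow> degen Z' n k \<cdot> \<phi> n = \<phi> (n + 1) \<cdot> degen Z n k"

locale para_cyclic_morphism =
  source: para_cyclic_object C Z w + target: para_cyclic_object C Z' w' +
  simplicial_morphism C Z Z' \<phi>
  for C :: "('p, 'b) cat" (structure)
    and Z :: "('p, 'b) simplicial_data" and w :: "nat \<Rightarrow> 'b"
    and Z' :: "('p, 'b) simplicial_data" and w' :: "nat \<Rightarrow> 'b" and \<phi> :: "nat \<Rightarrow> 'b" +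
  assumes mor_cyc: "w' n \<cdot> \<phi> n = \<phi> n \<cdot> w n"

definition Zobj :: "('o, 'a, 'p, 'b) septuple \<Rightarrow> 'o \<Rightarrow> ('p, 'b) simplicial_data" where
  "Zobj S X = \<lparr>
    deg = (\<lambda>n. fobj (PiF S \<star> Tl S ^^^ (n + 1)) X),
    face = (\<lambda>n k. (PiF S \<star> Tl S ^^^ k \<rhd> counit (Tl S) \<lhd> Tl S ^^^ (n - k)) X),
    degen = (\<lambda>n k. (PiF S \<star> Tl S ^^^ k \<rhd> comult (Tl S) \<lhd> Tl S ^^^ (n - k)) X)\<rparr>"

definition Zcyc :: "('o, 'a, 'p, 'b) septuple \<Rightarrow> 'o \<Rightarrow> 'a \<Rightarrow> nat \<Rightarrow> 'b" where
  "Zcyc S X w n =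
    (itr S \<lhd> Tl S ^^^ n) X \<cdot>\<^bsub>catC S\<^esub> t0 S n X \<cdot>\<^bsub>catC S\<^esub> farr (PiF S \<star> Tl S ^^^ n) w"

end

theory Submission
  imports Defs
begin

text \<open>Write \<open>w\<^sub>n = iT\<^sub>l\<^sup>nX \<circ> \<Pi>v\<^sub>n\<close> with \<open>v\<^sub>n : T\<^sub>l\<^sup>n\<^sup>+\<^sup>1X \<rightarrow> T\<^sub>rT\<^sub>l\<^sup>nX\<close> in \<open>\<M>\<close>.  The faces and degeneracies
  with index \<open>k \<ge> 1\<close> pass \<open>i\<close> by naturality and the law \<open>t\<close> by its compatibility with \<open>\<epsilon>\<close> and
  \<open>\<Delta>\<close> of \<open>T\<^sub>l\<close>.  For \<open>k = 0\<close> the axioms of \<open>i\<close> turn \<open>\<epsilon>\<close> and \<open>\<Delta>\<close> of \<open>T\<^sub>l\<close> into those of \<open>T\<^sub>r\<close>,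
  which travel through the law to meet \<open>w\<close>; the square in \<open>s\<^sub>0w\<^sub>n = w\<^sub>n\<^sub>+\<^sub>1\<^sup>2s\<^sub>n\<close> comes from
  \<open>\<Delta>\<^sub>r \<circ> v\<^sub>n = T\<^sub>rv\<^sub>n \<circ> v\<^sub>n\<^sub>+\<^sub>1 \<circ> T\<^sub>l\<^sup>n\<Delta>\<^sub>l\<close> together with \<open>v\<^sub>n\<^sub>+\<^sub>1 = t \<circ> T\<^sub>lv\<^sub>n\<close>.\<close>

section \<open>Simplifier normal forms for categories, functors and natural transformations\<close>

lemma hom_iff: "f \<in> hom C X Y \<longleftrightarrow> f \<in> arr C \<and> src C f = X \<and> tgt C f = Y"
  by (simp add: hom_def)

lemma fcomp_simps [simp]:
  "fobj (G \<star> F) X = fobj G (fobj F X)" "farr (G \<star> F) f = farr G (farr F f)"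
  by (simp_all add: fcomp_def)

lemma fid_simps [simp]: "fobj fid X = X" "farr fid f = f"
  by (simp_all add: fid_def)

text \<open>\<open>fpow\<close> builds a record at each stage. Reading off the two fields as
  function powers lets all later index arithmetic run on \<open>funpow\<close>.\<close>

lemma fpow_eq_funpow [simp]:
  "fobj (T ^^^ n) X = (fobj T ^^ n) X" "farr (T ^^^ n) f = (farr T ^^ n) f"
  by (induction n) simp_all

text \<open>Single applications are moved outermost, which agrees with the unfolding of
  \<open>h ^^ Suc n\<close>, so both ways of reaching an iterate get one normal form.\<close>

lemma funpow_swap [simp]: "(h ^^ n) (h x) = h ((h ^^ n) x)"
  by (simp add: funpow_swap1)

lemma funpow_funpow [simp]: "(h ^^ m) ((h ^^ n) x) = (h ^^ (m + n)) x"
  by (simp add: funpow_add)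

context category
begin

lemma obj_src_tgt [simp]: "f \<in> arr C \<Longrightarrow> src C f \<in> obj C" "f \<in> arr C \<Longrightarrow> tgt C f \<in> obj C"
  by (auto intro: src_in tgt_in)

lemma ident_simps [simp]:
  assumes "X \<in> obj C"
  shows "ident C X \<in> arr C" "src C (ident C X) = X" "tgt C (ident C X) = X"
  using ident_hom[OF assms] by (auto simp: hom_iff)

lemma cmp_simps [simp]:
  assumes "f \<in> arr C" "g \<in> arr C" "tgt C f = src C g"
  shows "g \<cdot> f \<in> arr C" "src C (g \<cdot> f) = src C f" "tgt C (g \<cdot> f) = tgt C g"
  using cmp_hom[of f "src C f" "tgt C f" g "tgt C g"] assms by (auto simp: hom_iff)

lemma cmp_ident [simp]:
  "\<lbrakk>f \<in> arr C; tgt C f = Y\<rbrakk> \<Longrightarrow> ident C Y \<cdot> f = f"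
  "\<lbrakk>f \<in> arr C; src C f = X\<rbrakk> \<Longrightarrow> f \<cdot> ident C X = f"
  by (auto intro!: ident_left ident_right simp: hom_iff)

text \<open>Composites are normalised to right-nested form. Later calculations therefore bracket an
  adjacent pair explicitly before rewriting it.\<close>

lemma assoc [simp]:
  "\<lbrakk>f \<in> arr C; g \<in> arr C; h \<in> arr C; tgt C f = src C g; tgt C g = src C h\<rbrakk>
    \<Longrightarrow> (h \<cdot> g) \<cdot> f = h \<cdot> g \<cdot> f"
  by (rule cmp_assoc) (auto simp: hom_iff)

end

context cat_functor
begin

lemma fobj_simp [simp]: "X \<in> obj C \<Longrightarrow> fobj F X \<in> obj D"
  by (rule fobj_in)

lemma farr_simps [simp]:
  assumes "f \<in> arr C"
  shows "farr F f \<in> arr D" "src D (farr F f) = fobj F (src C f)" "tgt D (farr F f) = fobj F (tgt C f)"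
  using farr_hom[of f "src C f" "tgt C f"] assms by (auto simp: hom_iff)

lemma farr_ident_simp [simp]: "X \<in> obj C \<Longrightarrow> farr F (ident C X) = ident D (fobj F X)"
  by (rule farr_ident)

lemma farr_cmp_simp [simp]:
  "\<lbrakk>f \<in> arr C; g \<in> arr C; tgt C f = src C g\<rbrakk>
    \<Longrightarrow> farr F (g \<cdot>\<^bsub>C\<^esub> f) = farr F g \<cdot>\<^bsub>D\<^esub> farr F f"
  by (rule farr_cmp) (auto simp: hom_iff)

text \<open>\<open>farr_cmp_simp\<close> splits the image of every composite, so an equation of
  composites in \<open>C\<close> no longer matches after \<open>F\<close> is applied. This carries
  it over already split.\<close>

lemma farr_cong:
  "\<lbrakk>g \<cdot>\<^bsub>C\<^esub> f = g' \<cdot>\<^bsub>C\<^esub> f'; f \<in> arr C; g \<in> arr C; tgt C f = src C g;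
    f' \<in> arr C; g' \<in> arr C; tgt C f' = src C g'\<rbrakk>
    \<Longrightarrow> farr F g \<cdot>\<^bsub>D\<^esub> farr F f = farr F g' \<cdot>\<^bsub>D\<^esub> farr F f'"
  by (simp flip: farr_cmp_simp)

end

context nat_transformation
begin

lemma component_simps [simp]:
  assumes "X \<in> obj C"
  shows "\<alpha> X \<in> arr D" "src D (\<alpha> X) = fobj F X" "tgt D (\<alpha> X) = fobj G X"
  using component_hom[OF assms] by (auto simp: hom_iff)

lemma natural:
  "\<lbrakk>f \<in> arr C; src C f = X; tgt C f = Y\<rbrakk> \<Longrightarrow> \<alpha> Y \<cdot>\<^bsub>D\<^esub> farr F f = farr G f \<cdot>\<^bsub>D\<^esub> \<alpha> X"
  by (rule naturality) (auto simp: hom_iff)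

end

section \<open>Iterates of an endofunctor and of the comonad structure maps\<close>

locale endofunctor = cat_functor M M T
  for M :: "('o, 'a) cat" and T :: "('o, 'a, 'o, 'a, 'x) cfunctor_scheme"
begin

lemma fobj_iter [simp]: "X \<in> obj M \<Longrightarrow> (fobj T ^^ n) X \<in> obj M"
  by (induction n) simp_all

lemma farr_iter [simp]:
  assumes "f \<in> arr M"
  shows "(farr T ^^ n) f \<in> arr M" "src M ((farr T ^^ n) f) = (fobj T ^^ n) (src M f)"
    "tgt M ((farr T ^^ n) f) = (fobj T ^^ n) (tgt M f)"
  using assms by (induction n) simp_all

lemma farr_iter_ident [simp]:
  "X \<in> obj M \<Longrightarrow> (farr T ^^ n) (ident M X) = ident M ((fobj T ^^ n) X)"
  by (induction n) simp_all

lemma farr_iter_cmp [simp]: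
  "\<lbrakk>f \<in> arr M; g \<in> arr M; tgt M f = src M g\<rbrakk>
    \<Longrightarrow> (farr T ^^ n) (g \<cdot>\<^bsub>M\<^esub> f) = (farr T ^^ n) g \<cdot>\<^bsub>M\<^esub> (farr T ^^ n) f"
  by (induction n) simp_all

end

sublocale comonad \<subseteq> functor_T: endofunctor M T ..

context comonad
begin

text \<open>Naturality with \<open>T ^^^ j\<close> applied. It yields the simplicial identities in
  which a face at position \<open>j\<close> slides past a map acting further to the right.\<close>

lemma counit_iter_natural:
  assumes "f \<in> arr M" "src M f = X" "tgt M f = Y"
  shows "(farr T ^^ j) (counit T Y) \<cdot>\<^bsub>M\<^esub> (farr T ^^ Suc j) f =
    (farr T ^^ j) f \<cdot>\<^bsub>M\<^esub> (farr T ^^ j) (counit T X)"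
  using arg_cong[OF counit.natural[OF assms], of "farr T ^^ j"] assms by auto

lemma comult_iter_natural:
  assumes "f \<in> arr M" "src M f = X" "tgt M f = Y"
  shows "(farr T ^^ j) (comult T Y) \<cdot>\<^bsub>M\<^esub> (farr T ^^ Suc j) f =
    (farr T ^^ Suc (Suc j)) f \<cdot>\<^bsub>M\<^esub> (farr T ^^ j) (comult T X)"
  using arg_cong[OF comult.natural[OF assms], of "farr T ^^ j"] assms by auto

lemma comult_iter_coassoc:
  assumes "X \<in> obj M"
  shows "(farr T ^^ j) (comult T (fobj T X)) \<cdot>\<^bsub>M\<^esub> (farr T ^^ j) (comult T X) =
    (farr T ^^ Suc j) (comult T X) \<cdot>\<^bsub>M\<^esub> (farr T ^^ j) (comult T X)"
proof -
  have "farr T (comult T X) \<cdot>\<^bsub>M\<^esub> comult T X = comult T (fobj T X) \<cdot>\<^bsub>M\<^esub> comult T X"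
    using coassoc assms by (simp add: nt_eq_def vcomp_def whisker_left_def whisker_right_def)
  from arg_cong[OF this, of "farr T ^^ j"] show ?thesis using assms by simp
qed

lemma comult_iter_counit:
  assumes "X \<in> obj M"
  shows "(farr T ^^ j) (counit T (fobj T X)) \<cdot>\<^bsub>M\<^esub> (farr T ^^ j) (comult T X)
      = ident M ((fobj T ^^ Suc j) X)"
    and "(farr T ^^ Suc j) (counit T X) \<cdot>\<^bsub>M\<^esub> (farr T ^^ j) (comult T X)
      = ident M ((fobj T ^^ Suc j) X)"
proof -
  have "counit T (fobj T X) \<cdot>\<^bsub>M\<^esub> comult T X = ident M (fobj T X)"
    "farr T (counit T X) \<cdot>\<^bsub>M\<^esub> comult T X = ident M (fobj T X)"
    using counit_left counit_right assms
    by (simp_all add: nt_eq_def vcomp_def whisker_left_def whisker_right_def nt_id_def)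
  from this[THEN arg_cong, of "farr T ^^ j"] assms
  show "(farr T ^^ j) (counit T (fobj T X)) \<cdot>\<^bsub>M\<^esub> (farr T ^^ j) (comult T X)
      = ident M ((fobj T ^^ Suc j) X)"
    "(farr T ^^ Suc j) (counit T X) \<cdot>\<^bsub>M\<^esub> (farr T ^^ j) (comult T X)
      = ident M ((fobj T ^^ Suc j) X)"
    by simp_all
qed

end

section \<open>The iterated distributive law\<close>

text \<open>For \<open>L = T\<^sub>l\<close> and \<open>R = T\<^sub>r\<close>, the image of \<open>tau M L R t n\<close> under \<open>\<Pi>\<close> is \<open>t\<^sub>n\<^sup>0\<close>.\<close>

primrec tau :: "('o, 'a) cat \<Rightarrow> ('o, 'a, 'o, 'a, 'x) cfunctor_scheme
    \<Rightarrow> ('o, 'a, 'o, 'a, 'y) cfunctor_scheme \<Rightarrow> ('o \<Rightarrow> 'a) \<Rightarrow> nat \<Rightarrow> 'o \<Rightarrow> 'a" where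
  "tau M L R t 0 = (\<lambda>X. ident M (fobj R X))"
| "tau M L R t (Suc n) = (\<lambda>X. t ((fobj L ^^ n) X) \<cdot>\<^bsub>M\<^esub> farr L (tau M L R t n X))"

context dual_distributive_law
begin

abbreviation "Lo \<equiv> fobj Tl"
abbreviation "Ro \<equiv> fobj Tr"
abbreviation "La \<equiv> farr Tl"
abbreviation "Ra \<equiv> farr Tr"
abbreviation "\<tau> \<equiv> tau M Tl Tr t"
abbreviation law_cmp (infixr "\<odot>" 70) where "g \<odot> f \<equiv> g \<cdot>\<^bsub>M\<^esub> f"

lemma tau_simps [simp]:
  assumes "X \<in> obj M"
  shows "\<tau> n X \<in> arr M" "src M (\<tau> n X) = (Lo ^^ n) (Ro X)" "tgt M (\<tau> n X) = Ro ((Lo ^^ n) X)"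
  using assms by (induction n) simp_all

lemma law_natural: "\<lbrakk>f \<in> arr M; src M f = X; tgt M f = Y\<rbrakk> \<Longrightarrow> t Y \<odot> La (Ra f) = Ra (La f) \<odot> t X"
  using law.natural by simp

lemma law_comult_right:
  "X \<in> obj M \<Longrightarrow> comult Tr (Lo X) \<odot> t X = Ra (t X) \<odot> t (Ro X) \<odot> La (comult Tr X)"
  using comult_right by (simp add: nt_eq_def vcomp_def whisker_left_def whisker_right_def)

lemma law_comult_left:
  "X \<in> obj M \<Longrightarrow> Ra (comult Tl X) \<odot> t X = t (Lo X) \<odot> La (t X) \<odot> comult Tl (Ro X)"
  using comult_left by (simp add: nt_eq_def vcomp_def whisker_left_def whisker_right_def)

lemma law_counit_right: "X \<in> obj M \<Longrightarrow> counit Tr (Lo X) \<odot> t X = La (counit Tr X)"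
  using counit_right by (simp add: nt_eq_def vcomp_def whisker_left_def whisker_right_def)

lemma law_counit_left: "X \<in> obj M \<Longrightarrow> Ra (counit Tl X) \<odot> t X = counit Tl (Ro X)"
  using counit_left by (simp add: nt_eq_def vcomp_def whisker_left_def whisker_right_def)

text \<open>The recursion of \<open>tau\<close> splits off the leftmost factor \<open>t\<close>;
  here the rightmost one is split off, the one that stands next to \<open>w\<close> in
  \<open>comult_right_v\<close>.\<close>

lemma tau_Suc_right: "X \<in> obj M \<Longrightarrow> \<tau> (Suc n) X = \<tau> n (Lo X) \<odot> (La ^^ n) (t X)"
  by (induction n) simp_all

lemma tau_natural:
  assumes "f \<in> arr M" "src M f = X" "tgt M f = Y"
  shows "\<tau> n Y \<odot> (La ^^ n) (Ra f) = Ra ((La ^^ n) f) \<odot> \<tau> n X"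
proof (induction n)
  case 0
  show ?case using assms by auto
next
  case (Suc n)
  have XY: "X \<in> obj M" "Y \<in> obj M" using assms by auto
  have "\<tau> (Suc n) Y \<odot> (La ^^ Suc n) (Ra f)
      = t ((Lo ^^ n) Y) \<odot> La (\<tau> n Y \<odot> (La ^^ n) (Ra f))"
    using assms XY by simp
  also have "\<dots> = (t ((Lo ^^ n) Y) \<odot> La (Ra ((La ^^ n) f))) \<odot> La (\<tau> n X)"
    unfolding Suc using assms XY by simp
  also have "t ((Lo ^^ n) Y) \<odot> La (Ra ((La ^^ n) f)) = Ra (La ((La ^^ n) f)) \<odot> t ((Lo ^^ n) X)"
    using assms by (intro law_natural) simp_all
  finally show ?case using assms XY by simp
qed

lemma tau_counit_right:
  assumes X: "X \<in> obj M"
  shows "counit Tr ((Lo ^^ n) X) \<odot> \<tau> n X = (La ^^ n) (counit Tr X)"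
proof (induction n)
  case (Suc n)
  have "counit Tr ((Lo ^^ Suc n) X) \<odot> \<tau> (Suc n) X
      = (counit Tr (Lo ((Lo ^^ n) X)) \<odot> t ((Lo ^^ n) X)) \<odot> La (\<tau> n X)"
    using X by simp
  also have "\<dots> = La (counit Tr ((Lo ^^ n) X) \<odot> \<tau> n X)"
    using X law_counit_right by simp
  finally show ?case unfolding Suc by simp
qed (use X in simp)

lemma tau_comult_right:
  assumes X: "X \<in> obj M"
  shows "comult Tr ((Lo ^^ n) X) \<odot> \<tau> n X = Ra (\<tau> n X) \<odot> \<tau> n (Ro X) \<odot> (La ^^ n) (comult Tr X)"
proof (induction n)
  case (Suc n)
  let ?Y = "(Lo ^^ n) X"
  have "comult Tr ((Lo ^^ Suc n) X) \<odot> \<tau> (Suc n) X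
      = (comult Tr (Lo ?Y) \<odot> t ?Y) \<odot> La (\<tau> n X)"
    using X by simp
  also have "\<dots> = Ra (t ?Y) \<odot> t (Ro ?Y) \<odot> La (comult Tr ?Y \<odot> \<tau> n X)"
    unfolding law_comult_right[OF left.functor_T.fobj_iter[OF X]] using X by simp
  also have "\<dots> = Ra (t ?Y) \<odot> (t (Ro ?Y) \<odot> La (Ra (\<tau> n X))) \<odot> La (\<tau> n (Ro X) \<odot> (La ^^ n) (comult Tr X))"
    unfolding Suc using X by simp
  \<comment> \<open>Naturality of \<open>t\<close> exchanges the middle pair, after which the left
    half assembles to \<open>Ra (\<tau> (Suc n) X)\<close> and the right half to
    \<open>\<tau> (Suc n) (Ro X)\<close>.\<close>
  also have "t (Ro ?Y) \<odot> La (Ra (\<tau> n X)) = Ra (La (\<tau> n X)) \<odot> t ((Lo ^^ n) (Ro X))"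
    using X by (intro law_natural) simp_all
  finally show ?case using X by simp
qed (use X in simp)

text \<open>Induction on the position \<open>j\<close>. For \<open>j > 0\<close> the outermost
  \<open>t\<close> is passed by naturality; for \<open>j = 0\<close> it is absorbed by
  \<open>law_counit_left\<close>, and naturality of the counit passes the remaining
  \<open>\<tau> q X\<close>.\<close>

lemma tau_counit_left:
  assumes X: "X \<in> obj M"
  shows "Ra ((La ^^ j) (counit Tl ((Lo ^^ q) X))) \<odot> \<tau> (Suc (j + q)) X
    = \<tau> (j + q) X \<odot> (La ^^ j) (counit Tl ((Lo ^^ q) (Ro X)))"
proof (induction j)
  case 0
  have "Ra (counit Tl ((Lo ^^ q) X)) \<odot> t ((Lo ^^ q) X) \<odot> La (\<tau> q X)
     = (Ra (counit Tl ((Lo ^^ q) X)) \<odot> t ((Lo ^^ q) X)) \<odot> La (\<tau> q X)"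
    using X by simp
  also have "\<dots> = counit Tl (Ro ((Lo ^^ q) X)) \<odot> La (\<tau> q X)"
    using X by (simp only: law_counit_left left.functor_T.fobj_iter)
  also have "\<dots> = \<tau> q X \<odot> counit Tl ((Lo ^^ q) (Ro X))"
    using X left.counit.natural[of "\<tau> q X"] by simp
  finally show ?case by simp
next
  case (Suc j)
  let ?e = "\<lambda>j X. (La ^^ j) (counit Tl ((Lo ^^ q) X))"
  have "Ra (?e (Suc j) X) \<odot> \<tau> (Suc (Suc j + q)) X
      = (Ra (La (?e j X)) \<odot> t ((Lo ^^ Suc (j + q)) X)) \<odot> La (\<tau> (Suc (j + q)) X)"
    using X by simp
  also have "Ra (La (?e j X)) \<odot> t ((Lo ^^ Suc (j + q)) X) = t ((Lo ^^ (j + q)) X) \<odot> La (Ra (?e j X))"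
    using X by (intro law_natural[symmetric]) simp_all
  also have "(t ((Lo ^^ (j + q)) X) \<odot> La (Ra (?e j X))) \<odot> La (\<tau> (Suc (j + q)) X)
      = t ((Lo ^^ (j + q)) X) \<odot> La (Ra (?e j X) \<odot> \<tau> (Suc (j + q)) X)"
    using X by simp
  finally show ?case unfolding Suc using X by simp
qed

text \<open>Same induction as for the counit, except that at \<open>j = 0\<close> the axiom
  \<open>law_comult_left\<close> replaces one factor \<open>t\<close> by two, which accounts for the
  extra \<open>Suc\<close>.\<close>

lemma tau_comult_left:
  assumes X: "X \<in> obj M"
  shows "Ra ((La ^^ j) (comult Tl ((Lo ^^ q) X))) \<odot> \<tau> (Suc (j + q)) X
    = \<tau> (Suc (Suc (j + q))) X \<odot> (La ^^ j) (comult Tl ((Lo ^^ q) (Ro X)))"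
proof (induction j)
  case 0
  have "Ra (comult Tl ((Lo ^^ q) X)) \<odot> t ((Lo ^^ q) X) \<odot> La (\<tau> q X)
     = (Ra (comult Tl ((Lo ^^ q) X)) \<odot> t ((Lo ^^ q) X)) \<odot> La (\<tau> q X)"
    using X by simp
  also have "\<dots> = t (Lo ((Lo ^^ q) X)) \<odot> La (t ((Lo ^^ q) X)) \<odot>
      (comult Tl (Ro ((Lo ^^ q) X)) \<odot> La (\<tau> q X))"
    unfolding law_comult_left[OF left.functor_T.fobj_iter[OF X]] using X by simp
  also have "comult Tl (Ro ((Lo ^^ q) X)) \<odot> La (\<tau> q X)
      = La (La (\<tau> q X)) \<odot> comult Tl ((Lo ^^ q) (Ro X))"
    using X left.comult.natural[of "\<tau> q X"] by simp
  finally show ?case using X by simp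
next
  case (Suc j)
  let ?e = "\<lambda>j X. (La ^^ j) (comult Tl ((Lo ^^ q) X))"
  have "Ra (?e (Suc j) X) \<odot> \<tau> (Suc (Suc j + q)) X
      = (Ra (La (?e j X)) \<odot> t ((Lo ^^ Suc (j + q)) X)) \<odot> La (\<tau> (Suc (j + q)) X)"
    using X by simp
  also have "Ra (La (?e j X)) \<odot> t ((Lo ^^ Suc (j + q)) X)
      = t ((Lo ^^ Suc (Suc (j + q))) X) \<odot> La (Ra (?e j X))"
    using X by (intro law_natural[symmetric]) simp_all
  also have "(t ((Lo ^^ Suc (Suc (j + q))) X) \<odot> La (Ra (?e j X))) \<odot> La (\<tau> (Suc (j + q)) X)
      = t ((Lo ^^ Suc (Suc (j + q))) X) \<odot> La (Ra (?e j X) \<odot> \<tau> (Suc (j + q)) X)"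
    using X by simp
  finally show ?case unfolding Suc using X by simp
qed

end

section \<open>The simplicial object of a dual admissible septuple\<close>

context dual_admissible_septuple
begin

abbreviation "M \<equiv> catM S"
abbreviation "C \<equiv> catC S"
abbreviation "Lo \<equiv> fobj (Tl S)"
abbreviation "Ro \<equiv> fobj (Tr S)"
abbreviation "Po \<equiv> fobj (PiF S)"
abbreviation "La \<equiv> farr (Tl S)"
abbreviation "Ra \<equiv> farr (Tr S)"
abbreviation "Pa \<equiv> farr (PiF S)"
abbreviation "\<tau> \<equiv> tau M (Tl S) (Tr S) (tlaw S)"
abbreviation cmpM (infixr "\<odot>" 70) where "g \<odot> f \<equiv> g \<cdot>\<^bsub>M\<^esub> f"
abbreviation cmpC (infixr "\<diamondop>" 70) where "g \<diamondop> f \<equiv> g \<cdot>\<^bsub>C\<^esub> f"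

lemma Zobj_simps [simp]:
  "deg (Zobj S X) n = Po ((Lo ^^ Suc n) X)"
  "face (Zobj S X) n k = Pa ((La ^^ k) (counit (Tl S) ((Lo ^^ (n - k)) X)))"
  "degen (Zobj S X) n k = Pa ((La ^^ k) (comult (Tl S) ((Lo ^^ (n - k)) X)))"
  by (simp_all add: Zobj_def whisker_left_def whisker_right_def)

lemma simplicial_Zobj:
  assumes X: "X \<in> obj M"
  shows "simplicial_object C (Zobj S X)"
proof
  fix n k :: nat
  show "deg (Zobj S X) n \<in> obj C"
    using X by simp
  show "face (Zobj S X) n k \<in> hom C (deg (Zobj S X) n) (deg (Zobj S X) (n - 1))"
    if "n \<ge> 1" "k \<le> n"
  proof -
    obtain p where "n = Suc p" using \<open>n \<ge> 1\<close> by (cases n) auto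
    with that X show ?thesis by (simp add: hom_iff)
  qed
  show "degen (Zobj S X) n k \<in> hom C (deg (Zobj S X) n) (deg (Zobj S X) (n + 1))" if "k \<le> n"
    using that X by (simp add: hom_iff)
  show "face (Zobj S X) (n + 1) k \<diamondop> degen (Zobj S X) n k = ident C (deg (Zobj S X) n)"
    if "k \<le> n"
  proof -
    obtain q where n: "n = k + q" using \<open>k \<le> n\<close> le_Suc_ex by blast
    show ?thesis using X
      distr.left.comult_iter_counit(1)[of "(Lo ^^ q) X" k]
      by (simp add: n flip: Pi.farr_cmp_simp)
  qed
  show "face (Zobj S X) (n + 1) (k + 1) \<diamondop> degen (Zobj S X) n k = ident C (deg (Zobj S X) n)"
    if "k \<le> n"
  proof -
    obtain q where n: "n = k + q" using \<open>k \<le> n\<close> le_Suc_ex by blast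
    show ?thesis using X
      distr.left.comult_iter_counit(2)[of "(Lo ^^ q) X" k]
      by (simp add: n flip: Pi.farr_cmp_simp)
  qed
next
  fix n j k :: nat
  assume "j < k" "k \<le> n"
  \<comment> \<open>With \<open>k = j + 1 + m\<close> and \<open>n = k + q\<close>, the map at
    \<open>k\<close> is the image under \<open>La ^^ Suc j\<close> of \<open>?f\<close> or
    \<open>?g\<close>, so naturality of the counit at position \<open>j\<close> gives both
    identities.\<close>
  then obtain m q where k: "k = Suc (j + m)" and n: "n = Suc (j + m) + q"
    by (metis le_Suc_ex less_imp_Suc_add)
  have [simp]: "Suc (j + (m + q)) - j = Suc (m + q)" by simp
  let ?f = "(La ^^ m) (counit (Tl S) ((Lo ^^ q) X))"
  let ?g = "(La ^^ m) (comult (Tl S) ((Lo ^^ q) X))"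
  show "face (Zobj S X) (n - 1) j \<diamondop> face (Zobj S X) n k
      = face (Zobj S X) (n - 1) (k - 1) \<diamondop> face (Zobj S X) n j"
    using X Pi.farr_cong[OF distr.left.counit_iter_natural[of ?f, OF _ refl refl, of j]]
    by (simp add: k n add.assoc)
  show "face (Zobj S X) (n + 1) j \<diamondop> degen (Zobj S X) n k
      = degen (Zobj S X) (n - 1) (k - 1) \<diamondop> face (Zobj S X) n j"
    using X Pi.farr_cong[OF distr.left.counit_iter_natural[of ?g, OF _ refl refl, of j]]
    by (simp add: k n add.assoc)
next
  fix n j k :: nat
  assume "j \<le> k" "k \<le> n"
  then obtain m q where k: "k = j + m" and n: "n = j + m + q"
    by (metis le_Suc_ex)
  show "degen (Zobj S X) (n + 1) j \<diamondop> degen (Zobj S X) n k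
      = degen (Zobj S X) (n + 1) (k + 1) \<diamondop> degen (Zobj S X) n j"
  \<comment> \<open>Equal indices are coassociativity; for \<open>j < k\<close> the two
    comultiplications act in different places and naturality suffices.\<close>
  proof (cases m)
    case 0
    then show ?thesis
      using X Pi.farr_cong[OF distr.left.comult_iter_coassoc[of "(Lo ^^ q) X" j]]
      by (simp add: k n)
  next
    case (Suc p)
    have [simp]: "Suc (Suc (j + (p + q))) - j = Suc (Suc (p + q))" "Suc (j + (p + q)) - j = Suc (p + q)"
      by auto
    show ?thesis
      using X Pi.farr_cong[OF distr.left.comult_iter_natural
          [of "(La ^^ p) (comult (Tl S) ((Lo ^^ q) X))", OF _ refl refl, of j]]
      by (simp add: k n Suc add.assoc)
  qed
next
  fix n j k :: nat
  assume "k + 1 < j" "j \<le> n + 1"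
  \<comment> \<open>Here \<open>j = k + 2 + m\<close>, so the face is the image under
    \<open>La ^^ Suc (Suc k)\<close> of a morphism along which the comultiplication is
    natural.\<close>
  then obtain m q where j: "j = Suc (Suc (k + m))" and n: "n = Suc (k + m) + q"
    by (metis Suc_eq_plus1 add_Suc le_Suc_ex less_imp_Suc_add Suc_le_mono)
  have [simp]: "Suc (k + (m + q)) - k = Suc (m + q)" by simp
  show "face (Zobj S X) (n + 1) j \<diamondop> degen (Zobj S X) n k
      = degen (Zobj S X) (n - 1) k \<diamondop> face (Zobj S X) n (j - 1)"
    using X Pi.farr_cong[OF distr.left.comult_iter_natural
        [of "(La ^^ m) (counit (Tl S) ((Lo ^^ q) X))", OF _ refl refl, of k]]
    by (simp add: j n add.assoc)
qed

text \<open>Downward induction on the lower end \<open>m\<close> of the fold: the factors with index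
  at least \<open>m\<close> compose to the image under \<open>\<Pi>\<close> of \<open>T_l^m\<close>
  applied to \<open>\<tau> (n - m)\<close>.\<close>

lemma t0_eq_tau:
  assumes X: "X \<in> obj M"
  shows "t0 S n X = Pa (\<tau> n X)"
proof -
  let ?F = "\<lambda>k \<gamma>. (PiF S \<star> Tl S ^^^ k \<rhd> tlaw S \<lhd> Tl S ^^^ (n - 1 - k)) \<bullet>\<^bsub>C\<^esub> \<gamma>"
  let ?I = "nt_id C (PiF S \<star> Tl S ^^^ n \<star> Tr S)"
  have "foldr ?F [m..<n] ?I X = Pa ((La ^^ m) (\<tau> (n - m) X))" if "m \<le> n" for m
    using that
  proof (induction m rule: inc_induct)
    case base
    show ?case using X by (simp add: nt_id_def)
  next
    case (step m)
    then have "n - m = Suc (n - Suc m)" by simp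
    with step X show ?case
      by (simp add: upt_conv_Cons vcomp_def whisker_left_def whisker_right_def)
  qed
  from this[of 0] show ?thesis by (simp add: t0_def)
qed

lemma itr_natural: "\<lbrakk>f \<in> arr M; src M f = X; tgt M f = Y\<rbrakk> \<Longrightarrow> itr S Y \<diamondop> Pa (Ra f) = Pa (La f) \<diamondop> itr S X"
  using itr.natural by simp

lemma itr_counit_component:
  "X \<in> obj M \<Longrightarrow> Pa (counit (Tl S) X) \<diamondop> itr S X = Pa (counit (Tr S) X)"
  using itr_counit by (simp add: nt_eq_def vcomp_def whisker_left_def whisker_right_def)

lemma itr_comult_component:
  "X \<in> obj M \<Longrightarrow> Pa (comult (Tl S) X) \<diamondop> itr S X
    = itr S (Lo X) \<diamondop> Pa (tlaw S X) \<diamondop> itr S (Ro X) \<diamondop> Pa (comult (Tr S) X)"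
  using itr_comult by (simp add: nt_eq_def vcomp_def whisker_left_def whisker_right_def)

text \<open>This is \<open>v_n\<close> from the outline above; it lives in \<open>M\<close>, so the
  calculations with \<open>t\<close> and \<open>w\<close> can be made before \<open>\<Pi>\<close> is
  applied.\<close>

definition iter_transp :: "'o \<Rightarrow> 'a \<Rightarrow> nat \<Rightarrow> 'a" where
  "iter_transp X w n = \<tau> n X \<odot> (La ^^ n) w"

lemma transpositionD:
  assumes "transposition_morphism S X w"
  shows "X \<in> obj M" "w \<in> arr M" "src M w = Lo X" "tgt M w = Ro X"
    "counit (Tr S) X \<odot> w = counit (Tl S) X"
    "comult (Tr S) X \<odot> w = Ra w \<odot> tlaw S X \<odot> La w \<odot> comult (Tl S) X"
  using assms by (auto simp: transposition_morphism_def hom_iff)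

end

section \<open>The para-cyclic structure given by a transposition morphism\<close>

locale transposition = dual_admissible_septuple S
  for S :: "('o, 'a, 'p, 'b) septuple" +
  fixes X :: 'o and w :: 'a
  assumes transposition: "transposition_morphism S X w"
begin

lemmas X_in [simp] = transpositionD(1)[OF transposition]
  and w_simps [simp] = transpositionD(2-4)[OF transposition]
  and w_counit = transpositionD(5)[OF transposition]
  and w_comult = transpositionD(6)[OF transposition]

abbreviation "v \<equiv> iter_transp X w"

lemma v_simps [simp]:
  "v n \<in> arr M" "src M (v n) = (Lo ^^ Suc n) X" "tgt M (v n) = Ro ((Lo ^^ n) X)"
  by (simp_all add: iter_transp_def)

lemma v_Suc: "v (Suc n) = tlaw S ((Lo ^^ n) X) \<odot> La (v n)"
  by (simp add: iter_transp_def)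

lemma counit_right_v:
  "counit (Tr S) ((Lo ^^ n) X) \<odot> v n = (La ^^ n) (counit (Tl S) X)"
proof -
  have "counit (Tr S) ((Lo ^^ n) X) \<odot> v n
      = (counit (Tr S) ((Lo ^^ n) X) \<odot> \<tau> n X) \<odot> (La ^^ n) w"
    by (simp add: iter_transp_def)
  also have "\<dots> = (La ^^ n) (counit (Tr S) X \<odot> w)"
    unfolding distr.tau_counit_right[OF X_in] by simp
  finally show ?thesis unfolding w_counit .
qed

lemma counit_left_v:
  "Ra ((La ^^ j) (counit (Tl S) ((Lo ^^ q) X))) \<odot> v (Suc (j + q))
    = v (j + q) \<odot> (La ^^ j) (counit (Tl S) ((Lo ^^ Suc q) X))"
proof -
  let ?e = "\<lambda>X. (La ^^ j) (counit (Tl S) ((Lo ^^ q) X))"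
  have "Ra (?e X) \<odot> v (Suc (j + q)) = (Ra (?e X) \<odot> \<tau> (Suc (j + q)) X) \<odot> (La ^^ Suc (j + q)) w"
    by (simp add: iter_transp_def)
  also have "\<dots> = \<tau> (j + q) X \<odot> (?e (Ro X) \<odot> (La ^^ Suc (j + q)) w)"
    unfolding distr.tau_counit_left[OF X_in] by simp
  \<comment> \<open>Since \<open>La ^^ Suc (j + q)\<close> is \<open>La ^^ Suc j\<close> after
    \<open>La ^^ q\<close>, this is naturality of the counit along
    \<open>(La ^^ q) w\<close>.\<close>
  also have "?e (Ro X) \<odot> (La ^^ Suc (j + q)) w = (La ^^ (j + q)) w \<odot> ?e (Lo X)"
    using distr.left.counit_iter_natural[of "(La ^^ q) w", OF _ refl refl, of j] by simp
  finally show ?thesis by (simp add: iter_transp_def)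
qed

lemma comult_left_v:
  "Ra ((La ^^ j) (comult (Tl S) ((Lo ^^ q) X))) \<odot> v (Suc (j + q))
    = v (Suc (Suc (j + q))) \<odot> (La ^^ j) (comult (Tl S) ((Lo ^^ Suc q) X))"
proof -
  let ?e = "\<lambda>X. (La ^^ j) (comult (Tl S) ((Lo ^^ q) X))"
  have "Ra (?e X) \<odot> v (Suc (j + q)) = (Ra (?e X) \<odot> \<tau> (Suc (j + q)) X) \<odot> (La ^^ Suc (j + q)) w"
    by (simp add: iter_transp_def)
  also have "\<dots> = \<tau> (Suc (Suc (j + q))) X \<odot> (?e (Ro X) \<odot> (La ^^ Suc (j + q)) w)"
    unfolding distr.tau_comult_left[OF X_in] by simp
  also have "?e (Ro X) \<odot> (La ^^ Suc (j + q)) w = (La ^^ Suc (Suc (j + q))) w \<odot> ?e (Lo X)"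
    using distr.left.comult_iter_natural[of "(La ^^ q) w", OF _ refl refl, of j] by simp
  finally show ?thesis by (simp add: iter_transp_def)
qed

text \<open>The comultiplication of \<open>T_r\<close> doubles \<open>\<tau> n\<close>, then meets
  \<open>w\<close> and doubles it by the transposition axiom; the two copies of each must be sorted
  into \<open>v n\<close> and \<open>v (Suc n)\<close>.\<close>

lemma comult_right_v:
  "comult (Tr S) ((Lo ^^ n) X) \<odot> v n = Ra (v n) \<odot> v (Suc n) \<odot> (La ^^ n) (comult (Tl S) X)"
proof -
  have "comult (Tr S) ((Lo ^^ n) X) \<odot> v n
      = (comult (Tr S) ((Lo ^^ n) X) \<odot> \<tau> n X) \<odot> (La ^^ n) w"
    by (simp add: iter_transp_def)
  also have "\<dots> = Ra (\<tau> n X) \<odot> \<tau> n (Ro X) \<odot> (La ^^ n) (comult (Tr S) X \<odot> w)"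
    unfolding distr.tau_comult_right[OF X_in] by simp
  also have "\<dots> = Ra (\<tau> n X) \<odot> (\<tau> n (Ro X) \<odot> (La ^^ n) (Ra w)) \<odot>
      (La ^^ n) (tlaw S X) \<odot> (La ^^ Suc n) w \<odot> (La ^^ n) (comult (Tl S) X)"
    unfolding w_comult by simp
  \<comment> \<open>One copy of \<open>w\<close> moves left past \<open>\<tau> n\<close> and
    completes \<open>Ra (v n)\<close>; what remains is \<open>v (Suc n)\<close> with its rightmost
    \<open>t\<close> split off.\<close>
  also have "\<tau> n (Ro X) \<odot> (La ^^ n) (Ra w) = Ra ((La ^^ n) w) \<odot> \<tau> n (Lo X)"
    by (rule distr.tau_natural) simp_all
  also have "Ra (\<tau> n X) \<odot> (Ra ((La ^^ n) w) \<odot> \<tau> n (Lo X)) \<odot>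
      (La ^^ n) (tlaw S X) \<odot> (La ^^ Suc n) w \<odot> (La ^^ n) (comult (Tl S) X)
    = Ra (v n) \<odot> (\<tau> n (Lo X) \<odot> (La ^^ n) (tlaw S X)) \<odot> (La ^^ Suc n) w \<odot> (La ^^ n) (comult (Tl S) X)"
    by (simp add: iter_transp_def)
  also have "\<dots> = Ra (v n) \<odot> v (Suc n) \<odot> (La ^^ n) (comult (Tl S) X)"
    unfolding distr.tau_Suc_right[OF X_in, symmetric] by (simp add: iter_transp_def)
  finally show ?thesis .
qed

lemma Zcyc_eq: "Zcyc S X w n = itr S ((Lo ^^ n) X) \<diamondop> Pa (v n)"
  by (simp add: Zcyc_def t0_eq_tau whisker_right_def iter_transp_def)

text \<open>Naturality of \<open>i\<close> applies only to morphisms of the form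
  \<open>La f\<close>. Faces and degeneracies of index at least 1 have this form, as do the
  components of the induced morphism, so all three reduce to statements about \<open>v\<close> in
  \<open>M\<close>.\<close>

lemma Zcyc_push:
  assumes "f \<in> arr M" "src M f = (Lo ^^ n) X" "tgt M f = Y"
  shows "Pa (La f) \<diamondop> Zcyc S X w n = itr S Y \<diamondop> Pa (Ra f \<odot> v n)"
proof -
  have Y: "Y \<in> obj M" using assms by auto
  have "Pa (La f) \<diamondop> Zcyc S X w n = (Pa (La f) \<diamondop> itr S ((Lo ^^ n) X)) \<diamondop> Pa (v n)"
    using assms by (simp add: Zcyc_eq)
  also have "\<dots> = (itr S Y \<diamondop> Pa (Ra f)) \<diamondop> Pa (v n)"
    by (simp only: itr_natural[OF assms])
  finally show ?thesis using assms Y by simp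
qed

lemma para_cyclic_Zobj: "para_cyclic_object C (Zobj S X) (Zcyc S X w)"
proof -
  interpret simplicial_object C "Zobj S X"
    by (rule simplicial_Zobj) simp
  show ?thesis
  proof
    fix n k :: nat
    show "Zcyc S X w n \<in> hom C (deg (Zobj S X) n) (deg (Zobj S X) n)"
      by (simp add: Zcyc_eq hom_iff)
    show "face (Zobj S X) n 0 \<diamondop> Zcyc S X w n = face (Zobj S X) n n" if "n \<ge> 1"
    proof -
      have "face (Zobj S X) n 0 \<diamondop> Zcyc S X w n
          = (Pa (counit (Tl S) ((Lo ^^ n) X)) \<diamondop> itr S ((Lo ^^ n) X)) \<diamondop> Pa (v n)"
        by (simp add: Zcyc_eq)
      also have "\<dots> = Pa (counit (Tr S) ((Lo ^^ n) X) \<odot> v n)"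
        by (simp add: itr_counit_component)
      finally show ?thesis by (simp add: counit_right_v)
    qed
    show "degen (Zobj S X) n 0 \<diamondop> Zcyc S X w n
        = (Zcyc S X w (n + 1) \<diamondop> Zcyc S X w (n + 1)) \<diamondop> degen (Zobj S X) n n"
    proof -
      let ?Y = "(Lo ^^ n) X"
      have "degen (Zobj S X) n 0 \<diamondop> Zcyc S X w n
          = (Pa (comult (Tl S) ?Y) \<diamondop> itr S ?Y) \<diamondop> Pa (v n)"
        by (simp add: Zcyc_eq)
      also have "\<dots> = itr S (Lo ?Y) \<diamondop> Pa (tlaw S ?Y) \<diamondop> itr S (Ro ?Y) \<diamondop>
          Pa (comult (Tr S) ?Y \<odot> v n)"
        by (simp add: itr_comult_component)
      also have "\<dots> = itr S (Lo ?Y) \<diamondop> Pa (tlaw S ?Y) \<diamondop> (itr S (Ro ?Y) \<diamondop> Pa (Ra (v n))) \<diamondop>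
          Pa (v (Suc n)) \<diamondop> Pa ((La ^^ n) (comult (Tl S) X))"
        unfolding comult_right_v by simp
      \<comment> \<open>Moving \<open>v n\<close> to the left of \<open>i\<close> places it beside
        \<open>tlaw S ?Y\<close>, where \<open>v_Suc\<close> combines them to
        \<open>v (Suc n)\<close>. This produces the second factor \<open>w_{n+1}\<close>.\<close>
      also have "itr S (Ro ?Y) \<diamondop> Pa (Ra (v n)) = Pa (La (v n)) \<diamondop> itr S (Lo ?Y)"
        by (rule itr_natural) simp_all
      finally show ?thesis by (simp add: Zcyc_eq v_Suc)
    qed
    assume "1 \<le> k" "k \<le> n"
    \<comment> \<open>The shift \<open>k = j + 1\<close> exhibits \<open>d_k\<close> and
      \<open>s_k\<close> as images of \<open>La f\<close> with \<open>f\<close> acting at position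
      \<open>j\<close>, as \<open>Zcyc_push\<close> requires.\<close>
    then obtain j q where k: "k = Suc j" and n: "n = Suc (j + q)"
      by (metis One_nat_def Suc_le_D add_Suc le_Suc_ex)
    have [simp]: "Suc (j + q) - j = Suc q" by simp
    show "face (Zobj S X) n k \<diamondop> Zcyc S X w n = Zcyc S X w (n - 1) \<diamondop> face (Zobj S X) n (k - 1)"
      using Zcyc_push[of "(La ^^ j) (counit (Tl S) ((Lo ^^ q) X))" n "(Lo ^^ (j + q)) X"]
        counit_left_v[of j q]
      by (simp add: k n Zcyc_eq)
    show "degen (Zobj S X) n k \<diamondop> Zcyc S X w n = Zcyc S X w (n + 1) \<diamondop> degen (Zobj S X) n (k - 1)"
      using Zcyc_push[of "(La ^^ j) (comult (Tl S) ((Lo ^^ q) X))" n "(Lo ^^ Suc (Suc (j + q))) X"]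
        comult_left_v[of j q]
      by (simp add: k n Zcyc_eq)
  qed
qed

section \<open>Functoriality in the transposition morphism\<close>

lemma para_cyclic_morphism_Zobj:
  assumes w': "transposition_morphism S X' w'" and f: "f \<in> hom M X X'"
    and fw: "Ra f \<odot> w = w' \<odot> La f"
  shows "para_cyclic_morphism C (Zobj S X) (Zcyc S X w) (Zobj S X') (Zcyc S X' w')
    (\<lambda>n. farr (PiF S \<star> Tl S ^^^ (n + 1)) f)"
proof -
  interpret target: transposition S X' w'
    by unfold_locales (rule w')
  have f [simp]: "f \<in> arr M" "src M f = X" "tgt M f = X'"
    using f by (auto simp: hom_iff)
  interpret source: para_cyclic_object C "Zobj S X" "Zcyc S X w"
    by (rule para_cyclic_Zobj)
  interpret target: para_cyclic_object C "Zobj S X'" "Zcyc S X' w'"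
    by (rule target.para_cyclic_Zobj)
  show ?thesis
  proof
    fix n k :: nat
    show "farr (PiF S \<star> Tl S ^^^ (n + 1)) f \<in> hom C (deg (Zobj S X) n) (deg (Zobj S X') n)"
      by (simp add: hom_iff)
    show "Zcyc S X' w' n \<diamondop> farr (PiF S \<star> Tl S ^^^ (n + 1)) f
        = farr (PiF S \<star> Tl S ^^^ (n + 1)) f \<diamondop> Zcyc S X w n"
    proof -
      \<comment> \<open>By \<open>Zcyc_push\<close> for \<open>(La ^^ n) f\<close>, compatibility
        with the cyclic maps reduces to an equation between \<open>v n\<close> and
        \<open>target.v n\<close>; it follows by moving \<open>f\<close> through
        \<open>\<tau> n\<close> and then through \<open>w\<close>.\<close>
      have "Ra ((La ^^ n) f) \<odot> v n = (Ra ((La ^^ n) f) \<odot> \<tau> n X) \<odot> (La ^^ n) w"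
        by (simp add: iter_transp_def)
      also have "Ra ((La ^^ n) f) \<odot> \<tau> n X = \<tau> n X' \<odot> (La ^^ n) (Ra f)"
        by (rule distr.tau_natural[symmetric]) simp_all
      also have "(\<tau> n X' \<odot> (La ^^ n) (Ra f)) \<odot> (La ^^ n) w = \<tau> n X' \<odot> (La ^^ n) (Ra f \<odot> w)"
        by simp
      also have "\<dots> = target.v n \<odot> (La ^^ Suc n) f"
        unfolding fw by (simp add: iter_transp_def)
      finally show ?thesis
        using Zcyc_push[of "(La ^^ n) f" n "(Lo ^^ n) X'"] by (simp add: target.Zcyc_eq)
    qed
    assume "k \<le> n"
    then obtain q where n: "n = k + q" using le_Suc_ex by blast
    show "degen (Zobj S X') n k \<diamondop> farr (PiF S \<star> Tl S ^^^ (n + 1)) f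
        = farr (PiF S \<star> Tl S ^^^ (n + 1 + 1)) f \<diamondop> degen (Zobj S X) n k"
      using Pi.farr_cong[OF distr.left.comult_iter_natural[of "(La ^^ q) f", OF _ refl refl, of k]]
      by (simp add: n)
    show "face (Zobj S X') n k \<diamondop> farr (PiF S \<star> Tl S ^^^ (n + 1)) f
        = farr (PiF S \<star> Tl S ^^^ (n - 1 + 1)) f \<diamondop> face (Zobj S X) n k" if "n \<ge> 1"
    proof -
      \<comment> \<open>Subtraction is truncated, so this needs \<open>n \<ge> 1\<close>.\<close>
      have *: "n - 1 + 1 = n" using that by simp
      show ?thesis unfolding *
        using Pi.farr_cong[OF distr.left.counit_iter_natural[of "(La ^^ q) f", OF _ refl refl, of k]]
        by (simp add: n)
    qed
  qed
qed

end

theorem theorem1p23: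
  fixes S :: "('o, 'a, 'p, 'b) septuple" and X :: 'o and w :: 'a
  assumes "dual_admissible_septuple S"
    and "transposition_morphism S X w"
  shows "para_cyclic_object (catC S) (Zobj S X) (Zcyc S X w) \<and>
    (\<forall>X' w' f. ((X, w), f, (X', w')) \<in> hom (Wcat S) (X, w) (X', w') \<longrightarrow>
      para_cyclic_morphism (catC S) (Zobj S X) (Zcyc S X w) (Zobj S X') (Zcyc S X' w')
        (\<lambda>n. farr (PiF S \<star> Tl S ^^^ (n + 1)) f))"
proof -
  interpret transposition S X w
    using assms by (intro transposition.intro transposition_axioms.intro)
  show ?thesis
    using para_cyclic_Zobj para_cyclic_morphism_Zobj by (auto simp: Wcat_hom_iff)
qed

end
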